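(* Fix $f\in\mathbb{R}^m$ and let $p(\cdot|f)$ be the posterior density on $\mathbb{R}^n$ given by $p(u|f)\propto\exp(-E(u;K,f)-\alpha R(u))$, and let $\hat u_{\mathrm{CM}}=\int_{\mathbb{R}^n}u\,p(u|f)\,\mathrm{d}u$ be the conditional mean estimate. Let $F_1,\dots,F_N:\mathbb{R}^n\to\mathbb{R}$ be convex functions with finite expectation under $p(\cdot|f)$, and define $$C_{\mathrm{CM}}(\hat u,u)=\sum_{i=1}^N D_{F_i}^{\hat q_i}(u,\hat u),\qquad \hat q_i\in\partial F_i(\hat u).$$ Then $\hat u_{\mathrm{CM}}$ is a Bayes estimator for the cost $C_{\mathrm{CM}}$, that is, $$\hat u_{\mathrm{CM}}\in\arg\min_{\hat u\in\mathbb{R}^n}\int_{\mathbb{R}^n}C_{\mathrm{CM}}(\hat u,u)\,p(u|f)\,\mathrm{d}u .$$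
   Context: Setting: $K\in\mathbb{R}^{m\times n}$ is a linear forward operator, $f\in\mathbb{R}^m$ is the data, $\alpha>0$. The data fidelity $u\mapsto E(u;K,f)$ and the functional $R:\mathbb{R}^n\to\mathbb{R}$ are nonnegative, convex and Lipschitz-continuous on $\mathbb{R}^n$, and $\int_{\mathbb{R}^n}\exp(-E(u;K,f)-\alpha R(u))\,\mathrm{d}u<\infty$. The symbol $\propto$ means equality up to a positive factor independent of $u$; $p(\cdot|f)$ is normalized to be a probability density. For a convex function $F:\mathbb{R}^n\to\mathbb{R}$ and a subgradient $\hat q\in\partial F(\hat u)$, the Bregman distance is $D_F^{\hat q}(u,\hat u)=F(u)-F(\hat u)-\langle\hat q,u-\hat u\rangle$. In the cost $C_{\mathrm{CM}}$, for each $\hat u$ a subgradient $\hat q_i\in\partial F_i(\hat u)$ (depending on $\hat u$ but not on $u$) is chosen. A Bayes estimator for a cost $C$ is an estimator minimizing the expected cost; since the estimator depends only on $f$, this amounts to minimizing, for given $f$, the posterior expected cost $\hat u\mapsto\int C(\hat u,u)p(u|f)\,\mathrm{d}u$. *)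

theory Defs
  imports "HOL-Analysis.Analysis"
begin

definition subdifferential :: "('a::euclidean_space \<Rightarrow> real) \<Rightarrow> 'a \<Rightarrow> 'a set" where
  "subdifferential F v = {q. \<forall>u. F u \<ge> F v + q \<bullet> (u - v)}"

definition bregman_distance :: "('a::euclidean_space \<Rightarrow> real) \<Rightarrow> 'a \<Rightarrow> 'a \<Rightarrow> 'a \<Rightarrow> real" where
  "bregman_distance F q u v = F u - F v - q \<bullet> (u - v)"

text \<open>
  The normalising constant is an integral with respect to Lebesgue measure on the Borel sets;
  \<open>posterior_density\<close> is a probability density whenever the unnormalised density is integrable
  with respect to \<^const>\<open>lborel\<close>.
\<close>

definition unnormalized_posterior ::
    "(real^'n \<Rightarrow> real^'n^'m \<Rightarrow> real^'m \<Rightarrow> real) \<Rightarrow> (real^'n \<Rightarrow> real) \<Rightarrow> real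
      \<Rightarrow> real^'n^'m \<Rightarrow> real^'m \<Rightarrow> real^'n \<Rightarrow> real" where
  "unnormalized_posterior E R \<alpha> K f u = exp (- E u K f - \<alpha> * R u)"

definition posterior_density ::
    "(real^'n \<Rightarrow> real^'n^'m \<Rightarrow> real^'m \<Rightarrow> real) \<Rightarrow> (real^'n \<Rightarrow> real) \<Rightarrow> real
      \<Rightarrow> real^'n^'m \<Rightarrow> real^'m \<Rightarrow> real^'n \<Rightarrow> real" where
  "posterior_density E R \<alpha> K f u =
     unnormalized_posterior E R \<alpha> K f u / (\<integral>w. unnormalized_posterior E R \<alpha> K f w \<partial>lborel)"

definition cm_estimate :: "('a::euclidean_space \<Rightarrow> real) \<Rightarrow> 'a" where
  "cm_estimate p = (\<integral>u. p u *\<^sub>R u \<partial>lborel)"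

text \<open>The functions \<open>F\<^sub>1, \<dots>, F\<^sub>N\<close> are \<open>F 1, \<dots>, F N\<close>; \<open>q i v\<close> is the subgradient of \<open>F i\<close> chosen
  at the estimate \<open>v\<close>. The first argument \<open>v\<close> of the cost is the estimate, the second the truth.\<close>

definition cm_cost ::
    "nat \<Rightarrow> (nat \<Rightarrow> 'a::euclidean_space \<Rightarrow> real) \<Rightarrow> (nat \<Rightarrow> 'a \<Rightarrow> 'a) \<Rightarrow> 'a \<Rightarrow> 'a \<Rightarrow> real" where
  "cm_cost N F q v u = (\<Sum>i=1..N. bregman_distance (F i) (q i v) u v)"

text \<open>Pointwise in the data: \<open>x\<close> minimises the posterior expected cost under the density \<open>p\<close>.
  Integrability is required for every competitor because the Bochner integral of a
  non-integrable function is 0, which would make the minimisation meaningless.\<close>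

definition bayes_estimate ::
    "('a::euclidean_space \<Rightarrow> 'a \<Rightarrow> real) \<Rightarrow> ('a \<Rightarrow> real) \<Rightarrow> 'a \<Rightarrow> bool" where
  "bayes_estimate C p x \<longleftrightarrow>
     (\<forall>v. integrable lborel (\<lambda>u. C v u * p u)) \<and>
     is_arg_min (\<lambda>v. \<integral>u. C v u * p u \<partial>lborel) (\<lambda>v. True) x"

end

theory Submission
  imports Defs
begin

text \<open>The Bregman cost is affine in the truth up to the terms \<open>F\<^sub>i u\<close>, which do not depend on the
  estimate; hence the expected cost of \<open>v\<close> is a constant minus \<open>\<Sum>\<^sub>i F\<^sub>i v + q\<^sub>i v \<bullet> (m - v)\<close> with \<open>m\<close>
  the conditional mean, and the subgradient inequality tested at \<open>m\<close> says that this sum is at most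
  \<open>\<Sum>\<^sub>i F\<^sub>i m\<close>, its value at \<open>v = m\<close>. The existence of \<open>m\<close> has to be derived from log-concavity of
  \<open>g = exp (- J)\<close>: on unit balls strung along the segment from \<open>0\<close> to \<open>u\<close>, \<open>g\<close> is at least a
  constant times \<open>g u\<close>, so integrability bounds \<open>norm u * g u\<close>; and midpoint convexity gives
  \<open>g u \<le> g (u/2)\<^sup>2 / g 0\<close>, so that \<open>norm u * g u\<close> is dominated by a multiple of \<open>g (u/2)\<close>.\<close>

lemma integrable_lborel_scaleR:
  fixes g :: "'a::euclidean_space \<Rightarrow> real"
  assumes "integrable lborel g" "c \<noteq> 0"
  shows "integrable lborel (\<lambda>x. g (c *\<^sub>R x))"
proof -
  have [measurable]: "g \<in> borel_measurable borel"
    using assms(1) by auto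
  \<comment> \<open>By \<open>lborel_affine\<close>, Lebesgue measure is its own image under scaling
    by \<open>c\<close>, weighted with the Jacobian; the weight is a nonzero constant and can be
    cancelled.\<close>
  have "integrable (density (distr lborel borel (\<lambda>x. 0 + c *\<^sub>R x)) (\<lambda>_. ennreal (\<bar>c\<bar> ^ DIM('a)))) g"
    using assms lborel_affine[OF assms(2), of "0::'a"] by simp
  then have "integrable (distr lborel borel (\<lambda>x. 0 + c *\<^sub>R x)) (\<lambda>x. \<bar>c\<bar> ^ DIM('a) *\<^sub>R g x)"
    by (subst (asm) integrable_density) auto
  then show ?thesis
    using assms(2) by (subst (asm) integrable_distr_eq) auto
qed

text \<open>Since \<open>J\<close> is nonnegative, the convex combination bounding \<open>J\<close>
  on the segment from \<open>0\<close> to \<open>u\<close> is at most \<open>J 0 + J u\<close>;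
  moving less than 1 away from the segment adds at most \<open>L\<close>.\<close>

lemma log_concave_ball_lower_bound:
  fixes J :: "'a::euclidean_space \<Rightarrow> real"
  assumes "convex_on UNIV J" "L-lipschitz_on UNIV J" "\<And>u. J u \<ge> 0"
    and "0 \<le> t" "t \<le> 1" "dist w (t *\<^sub>R u) < 1"
  shows "exp (- L) * exp (- J 0) * exp (- J u) \<le> exp (- J w)"
proof -
  have "J (t *\<^sub>R u) \<le> (1 - t) * J 0 + t * J u"
    using convex_onD[OF assms(1), of t 0 u] assms by simp
  also have "\<dots> \<le> J 0 + J u"
    using assms(3)[of 0] assms(3)[of u] assms(4,5)
    by (intro add_mono) (auto intro: mult_left_le_one_le)
  finally have 1: "J (t *\<^sub>R u) \<le> J 0 + J u" .
  have "dist (J w) (J (t *\<^sub>R u)) \<le> L * dist w (t *\<^sub>R u)"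
    using lipschitz_onD[OF assms(2)] by simp
  also have "\<dots> \<le> L"
    using assms(6) lipschitz_on_nonneg[OF assms(2)] by (intro mult_left_le) auto
  finally have "J w \<le> J (t *\<^sub>R u) + L"
    by (simp add: dist_real_def)
  with 1 show ?thesis
    by (simp flip: exp_add)
qed

text \<open>The segment from \<open>0\<close> to \<open>u\<close> carries at least
  \<open>norm u / 2\<close> disjoint unit balls, each holding mass at least a constant times
  \<open>exp (- J u)\<close>, and the total mass is finite.\<close>

lemma norm_mult_log_concave_bounded:
  fixes J :: "'a::euclidean_space \<Rightarrow> real"
  assumes "convex_on UNIV J" "L-lipschitz_on UNIV J" "\<And>u. J u \<ge> 0"
    and "integrable lborel (\<lambda>u. exp (- J u))"
  obtains B where "\<And>u. norm u * exp (- J u) \<le> B"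
proof -
  \<comment> \<open>\<open>c * exp (- J u)\<close> is the mass that
    \<open>log_concave_ball_lower_bound\<close> guarantees on one ball.\<close>
  define c where "c = exp (- L) * exp (- J 0) * measure lborel (ball (0::'a) 1)"
  define Z where "Z = (\<integral>u. exp (- J u) \<partial>lborel)"
  have c: "c > 0"
    unfolding c_def using content_ball_pos[of 1 "0::'a"] by simp
  have "norm u * exp (- J u) \<le> 2 * Z / c" for u
  proof (cases "u = 0")
    case True
    have "Z \<ge> 0" unfolding Z_def by simp
    then show ?thesis using True c by simp
  next
    case False
    \<comment> \<open>The centres are spaced 2 apart along the ray through \<open>u\<close>, which
      makes the open unit balls disjoint. Indices up to \<open>n\<close> keep them on the segment;
      counting index 0 there are \<open>Suc n\<close> balls, enough for
      \<open>norm u \<le> 2 * Suc n\<close>.\<close>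
    define n where "n = nat \<lfloor>norm u / 2\<rfloor>"
    define x where "x k = (2 * real k / norm u) *\<^sub>R u" for k
    define U where "U = (\<Union>k\<in>{..n}. ball (x k) 1)"
    have "real n = of_int \<lfloor>norm u / 2\<rfloor>"
      by (simp add: n_def)
    then have n: "real n \<le> norm u / 2" "norm u / 2 \<le> real (Suc n)"
      by linarith+
    have disj: "disjoint_family_on (\<lambda>k. ball (x k) 1) {..n}"
    proof (unfold disjoint_family_on_def, intro ballI impI)
      fix j k :: nat
      assume "j \<noteq> k"
      have "x j - x k = ((2 * real j - 2 * real k) / norm u) *\<^sub>R u"
        unfolding x_def by (simp add: diff_divide_distrib flip: scaleR_left_diff_distrib)
      then have "dist (x j) (x k) = \<bar>2 * real j - 2 * real k\<bar>"
        using False by (simp add: dist_norm)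
      also have "\<dots> \<ge> 2" using \<open>j \<noteq> k\<close> by linarith
      finally show "ball (x j) 1 \<inter> ball (x k) 1 = {}"
        by (intro disjoint_ballI) simp
    qed
    have "measure lborel U = (\<Sum>k\<le>n. measure lborel (ball (x k) 1))"
      unfolding U_def using disj
      by (intro measure_finite_Union) (auto intro!: less_imp_neq emeasure_lborel_ball_finite
        simp flip: infinity_ennreal_def)
    also have "\<dots> = real (Suc n) * measure lborel (ball (0::'a) 1)"
      by (simp add: content_ball)
    finally have mU: "measure lborel U = \<dots>" .
    have fU: "emeasure lborel U < \<infinity>"
      unfolding U_def by (intro emeasure_bounded_finite bounded_UN) auto
    have U: "U \<in> sets lborel" unfolding U_def by auto
    have "norm u * (c * exp (- J u)) \<le> 2 * real (Suc n) * (c * exp (- J u))"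
      using n(2) c by (intro mult_right_mono) auto
    also have "\<dots> = 2 * (\<integral>w. (exp (- L) * exp (- J 0) * exp (- J u)) * indicator U w \<partial>lborel)"
      using U mU by (simp add: c_def)
    also have "(\<integral>w. (exp (- L) * exp (- J 0) * exp (- J u)) * indicator U w \<partial>lborel) \<le> Z"
      unfolding Z_def
    proof (intro integral_mono integrable_mult_right)
      show "integrable lborel (indicator U :: 'a \<Rightarrow> real)"
        using U fU by simp
      fix w :: 'a
      show "exp (- L) * exp (- J 0) * exp (- J u) * indicator U w \<le> exp (- J w)"
      proof (cases "w \<in> U")
        case True
        then obtain k where k: "k \<le> n" "dist w (x k) < 1"
          unfolding U_def by (auto simp: dist_commute)
        have "2 * real k / norm u \<le> 1" using k(1) n(1) False by simp
        then show ?thesis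
          using log_concave_ball_lower_bound[OF assms(1-3), of "2 * real k / norm u" w u] k(2) True
          by (simp add: x_def)
      qed auto
    qed fact
    finally show ?thesis using c by (simp add: field_simps)
  qed
  then show ?thesis by (rule that)
qed

lemma log_concave_integrable_first_moment:
  fixes J :: "'a::euclidean_space \<Rightarrow> real"
  assumes "convex_on UNIV J" "L-lipschitz_on UNIV J" "\<And>u. J u \<ge> 0"
    and int: "integrable lborel (\<lambda>u. exp (- J u))"
  shows "integrable lborel (\<lambda>u. exp (- J u) *\<^sub>R u)"
proof -
  obtain B where B: "\<And>u. norm u * exp (- J u) \<le> B"
    using norm_mult_log_concave_bounded[OF assms] by blast
  have [measurable]: "(\<lambda>u. exp (- J u)) \<in> borel_measurable borel"
    using int by auto
  have bound: "norm (exp (- J u) *\<^sub>R u) \<le> 2 * B * exp (J 0) * exp (- J ((1/2) *\<^sub>R u))" for u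
  proof -
    define v where "v = (1/2) *\<^sub>R u"
    have "J v \<le> (1 - 1/2) * J 0 + 1/2 * J u"
      using convex_onD[OF assms(1), of "1/2" 0 u] by (simp add: v_def)
    then have "exp (- J u) \<le> exp (J 0) * (exp (- J v) * exp (- J v))"
      by (simp flip: exp_add)
    then have "norm (exp (- J u) *\<^sub>R u) \<le> exp (J 0) * (exp (- J v) * exp (- J v)) * norm u"
      by (simp add: mult_right_mono)
    \<comment> \<open>One factor \<open>exp (- J v)\<close> absorbs
      \<open>norm u = 2 * norm v\<close> through \<open>B\<close>; the other survives as the
      integrable majorant.\<close>
    also have "\<dots> = 2 * exp (J 0) * exp (- J v) * (norm v * exp (- J v))"
      by (simp add: v_def)
    also have "\<dots> \<le> 2 * exp (J 0) * exp (- J v) * B"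
      by (intro mult_left_mono B) auto
    finally show ?thesis by (simp add: v_def mult_ac)
  qed
  show ?thesis
  proof (rule Bochner_Integration.integrable_bound)
    show "integrable lborel (\<lambda>u. 2 * B * exp (J 0) * exp (- J ((1/2) *\<^sub>R u)))"
      using integrable_lborel_scaleR[OF int, of "1/2"] by (intro integrable_mult_right) auto
    show "AE u in lborel. norm (exp (- J u) *\<^sub>R u)
        \<le> norm (2 * B * exp (J 0) * exp (- J ((1/2) *\<^sub>R u)))"
      using bound by (intro AE_I2) (metis abs_ge_self order_trans real_norm_def)
  qed measurable
qed

text \<open>The subgradient inequality is applied after integration, once for each \<open>i\<close>.
  By linearity the density enters through its mass 1, its mean and the expectations of the
  \<open>F i\<close>.\<close>

lemma bayes_estimate_cm_cost:
  fixes p :: "'a::euclidean_space \<Rightarrow> real"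
  assumes p: "integrable lborel p" "(\<integral>u. p u \<partial>lborel) = 1"
    and pu: "integrable lborel (\<lambda>u. p u *\<^sub>R u)"
    and Fp: "\<And>i. i \<in> {1..N} \<Longrightarrow> integrable lborel (\<lambda>u. F i u * p u)"
    and q: "\<And>i v. i \<in> {1..N} \<Longrightarrow> q i v \<in> subdifferential (F i) v"
  shows "bayes_estimate (cm_cost N F q) p (cm_estimate p)"
proof -
  define m where "m = cm_estimate p"
  define A where "A i = (\<integral>u. F i u * p u \<partial>lborel)" for i
  have cost: "cm_cost N F q v u * p u =
      (\<Sum>i=1..N. F i u * p u - (F i v - q i v \<bullet> v) * p u - q i v \<bullet> (p u *\<^sub>R u))" for v u
    unfolding cm_cost_def bregman_distance_def sum_distrib_right
    by (intro sum.cong) (auto simp: algebra_simps inner_diff_right)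
  \<comment> \<open>Deleting \<open>inner_scaleR_right\<close> keeps the linear term as a fixed
    vector paired with \<open>p u *\<^sub>R u\<close>, the form that \<open>pu\<close>
    covers.\<close>
  have int: "integrable lborel (\<lambda>u. cm_cost N F q v u * p u)" for v
    unfolding cost using p pu Fp
    by (intro Bochner_Integration.integrable_sum Bochner_Integration.integrable_diff)
      (auto simp del: inner_scaleR_right)
  have expected: "(\<integral>u. cm_cost N F q v u * p u \<partial>lborel) =
      (\<Sum>i=1..N. A i - (F i v + q i v \<bullet> (m - v)))" for v
  proof -
    have "(\<integral>u. cm_cost N F q v u * p u \<partial>lborel) =
      (\<Sum>i=1..N. \<integral>u. F i u * p u - (F i v - q i v \<bullet> v) * p u - q i v \<bullet> (p u *\<^sub>R u) \<partial>lborel)"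
      unfolding cost using p pu Fp
      by (intro Bochner_Integration.integral_sum Bochner_Integration.integrable_diff)
        (auto simp del: inner_scaleR_right)
    also have "\<dots> = (\<Sum>i=1..N. A i - (F i v + q i v \<bullet> (m - v)))"
    proof (rule sum.cong[OF refl])
      fix i assume i: "i \<in> {1..N}"
      have "(\<integral>u. q i v \<bullet> (p u *\<^sub>R u) \<partial>lborel) = q i v \<bullet> m"
        unfolding m_def cm_estimate_def using pu by (intro integral_inner_right) auto
      then show "(\<integral>u. F i u * p u - (F i v - q i v \<bullet> v) * p u - q i v \<bullet> (p u *\<^sub>R u) \<partial>lborel)
          = A i - (F i v + q i v \<bullet> (m - v))"
        using p pu Fp[OF i] by (simp add: A_def inner_diff_right del: inner_scaleR_right)
    qed
    finally show ?thesis .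
  qed
  have "(\<integral>u. cm_cost N F q m u * p u \<partial>lborel) \<le> (\<integral>u. cm_cost N F q v u * p u \<partial>lborel)" for v
    unfolding expected
  proof (rule sum_mono)
    fix i assume "i \<in> {1..N}"
    then have "F i m \<ge> F i v + q i v \<bullet> (m - v)"
      using q[of i v] by (simp add: subdifferential_def)
    then show "A i - (F i m + q i m \<bullet> (m - m)) \<le> A i - (F i v + q i v \<bullet> (m - v))"
      by simp
  qed
  then show ?thesis
    using int unfolding bayes_estimate_def is_arg_min_def m_def by (auto simp: not_less)
qed

text \<open>The first conjunct ensures that \<open>cm_estimate p\<close> is a true mean and not the
  default value 0 of the Bochner integral.\<close>

theorem theorem4p3:
  fixes K :: "real^'n^'m"
    and f :: "real^'m"
    and \<alpha> :: real
    and E :: "real^'n \<Rightarrow> real^'n^'m \<Rightarrow> real^'m \<Rightarrow> real"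
    and R :: "real^'n \<Rightarrow> real"
    and p :: "real^'n \<Rightarrow> real"
    and N :: nat
    and F :: "nat \<Rightarrow> real^'n \<Rightarrow> real"
    and q :: "nat \<Rightarrow> real^'n \<Rightarrow> real^'n"
  assumes "\<alpha> > 0"
    and "\<And>u. E u K f \<ge> 0"
    and "convex_on UNIV (\<lambda>u. E u K f)"
    and "\<exists>L. L-lipschitz_on UNIV (\<lambda>u. E u K f)"
    and "\<And>u. R u \<ge> 0"
    and "convex_on UNIV R"
    and "\<exists>L. L-lipschitz_on UNIV R"
    and "integrable lborel (\<lambda>u. exp (- E u K f - \<alpha> * R u))"
    and "p = posterior_density E R \<alpha> K f"
    and "\<And>i. i \<in> {1..N} \<Longrightarrow> convex_on UNIV (F i)"
    and "\<And>i. i \<in> {1..N} \<Longrightarrow> integrable lborel (\<lambda>u. F i u * p u)"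
    and "\<And>i v. i \<in> {1..N} \<Longrightarrow> q i v \<in> subdifferential (F i) v"
  shows "integrable lborel (\<lambda>u. p u *\<^sub>R u) \<and>
    bayes_estimate (cm_cost N F q) p (cm_estimate p)"
proof -
  define J where "J = (\<lambda>u. E u K f + \<alpha> * R u)"
  define Z where "Z = (\<integral>u. exp (- J u) \<partial>lborel)"
  obtain L1 L2 where L: "L1-lipschitz_on UNIV (\<lambda>u. E u K f)" "L2-lipschitz_on UNIV R"
    using assms(4,7) by blast
  have conv: "convex_on UNIV J"
    unfolding J_def using assms(1,3,6) by (intro convex_on_add convex_on_cmul) auto
  have lip: "(L1 + \<bar>\<alpha>\<bar> * L2)-lipschitz_on UNIV J"
    unfolding J_def using L by (intro lipschitz_on_add lipschitz_on_cmult_real)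
  have nonneg: "J u \<ge> 0" for u
    unfolding J_def using assms(1,2,5) by simp
  have int: "integrable lborel (\<lambda>u. exp (- J u))"
    using assms(8) by (simp add: J_def)
  have p: "p = (\<lambda>u. exp (- J u) / Z)"
    unfolding assms(9) posterior_density_def unnormalized_posterior_def Z_def J_def by simp
  \<comment> \<open>Otherwise division by 0 would turn \<open>p\<close> into the zero function. A
    positive function cannot vanish almost everywhere, as Lebesgue measure is not the null
    measure.\<close>
  have "Z \<noteq> 0"
  proof
    assume "Z = 0"
    then have "AE u in lborel. exp (- J u) = 0"
      unfolding Z_def using int by (subst (asm) integral_nonneg_eq_0_iff_AE) auto
    then have "AE u in (lborel :: (real^'n) measure). False" by simp
    then show False by (simp add: trivial_limit_def[symmetric] ae_filter_eq_bot_iff)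
  qed
  then have p_int: "integrable lborel p" "(\<integral>u. p u \<partial>lborel) = 1"
    using int by (auto simp: p Z_def)
  have "integrable lborel (\<lambda>u. (1 / Z) *\<^sub>R (exp (- J u) *\<^sub>R u))"
    by (intro integrable_scaleR_right log_concave_integrable_first_moment[OF conv lip nonneg int])
  then have pu: "integrable lborel (\<lambda>u. p u *\<^sub>R u)"
    by (simp add: p)
  show ?thesis
    using pu assms(11,12) by (intro conjI bayes_estimate_cm_cost p_int)
qed

end
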